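(* Let $n\ge 3$ and let $E$ and $F$ be any two non-isometric $n$-dimensional normed spaces. Then there are uncountably many geodesics between $E$ and $F$ in $(BM_n,\log d)$, where geodesics are counted by the subsets of $BM_n$ they trace out.
   Context: All normed spaces are real. For $n$-dimensional normed spaces $E,F$, the (multiplicative) Banach-Mazur distance is $d(E,F)=\inf\{\|T\|\,\|T^{-1}\| : T:E\to F \text{ is an isomorphism}\}$. $BM_n$ is the set of isometry classes of $n$-dimensional normed spaces, with the metric $\log d$; a space is identified with its isometry class. In a metric space $(M,\rho)$, the length of a path $\gamma:[a,b]\to M$ is $L(\gamma)=\sup\sum_{i=1}^m\rho(\gamma(t_i),\gamma(t_{i-1}))$ over all partitions $a=t_0\le t_1\le\cdots\le t_m=b$; a geodesic between $x$ and $y$ is a path $\gamma$ starting at $x$, ending at $y$, with $L(\gamma)=\rho(x,y)$. Two geodesics with the same image are regarded as the same. *)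

theory Defs
  imports "HOL-Analysis.Analysis"
begin

text \<open>An \<open>n\<close>-dimensional normed space is represented by a norm on \<open>real ^ 'n\<close>, where
  \<open>n = CARD('n)\<close>; lemma \<open>normed_space_representation\<close> below shows that, up to isometry, this covers
  all real normed spaces of dimension \<open>CARD('n)\<close>. The library \<open>norm\<close> on \<open>real ^ 'n\<close> is the Euclidean
  one and is only used as an auxiliary tool in proofs.\<close>

definition is_norm :: "('a::real_vector \<Rightarrow> real) \<Rightarrow> bool" where
  "is_norm N \<longleftrightarrow>
     (\<forall>x. 0 \<le> N x) \<and> (\<forall>x. N x = 0 \<longleftrightarrow> x = 0) \<and>
     (\<forall>c x. N (c *\<^sub>R x) = \<bar>c\<bar> * N x) \<and> (\<forall>x y. N (x + y) \<le> N x + N y)"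

typedef (overloaded) 'n normed_space = "{N :: real ^ 'n \<Rightarrow> real. is_norm N}"
  morphisms nrm normed_space_of
proof
  show "norm \<in> {N :: real ^ 'n \<Rightarrow> real. is_norm N}"
    by (simp add: is_norm_def norm_triangle_ineq)
qed

definition isometric :: "'n::finite normed_space \<Rightarrow> 'n normed_space \<Rightarrow> bool" where
  "isometric E F \<longleftrightarrow>
     (\<exists>T :: real ^ 'n \<Rightarrow> real ^ 'n. linear T \<and> bij T \<and> (\<forall>x. nrm F (T x) = nrm E x))"

definition op_norm ::
    "'n::finite normed_space \<Rightarrow> 'n normed_space \<Rightarrow> (real ^ 'n \<Rightarrow> real ^ 'n) \<Rightarrow> real" where
  "op_norm E F T = Sup {nrm F (T x) | x. nrm E x \<le> 1}"

text \<open>In finite dimension every linear bijection is bounded with bounded inverse, so the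
  isomorphisms of normed spaces are exactly the linear bijections.\<close>

definition banach_mazur :: "'n::finite normed_space \<Rightarrow> 'n normed_space \<Rightarrow> real" where
  "banach_mazur E F =
     Inf {op_norm E F T * op_norm F E (inv T) | T. linear T \<and> bij T}"

lemma is_norm_nrm: "is_norm (nrm E)"
  using nrm[of E] by simp

lemma nrm_nonneg [simp]: "0 \<le> nrm E x"
  and nrm_eq_0 [simp]: "nrm E x = 0 \<longleftrightarrow> x = 0"
  and nrm_scaleR: "nrm E (c *\<^sub>R x) = \<bar>c\<bar> * nrm E x"
  and nrm_triangle: "nrm E (x + y) \<le> nrm E x + nrm E y"
  using is_norm_nrm[of E] unfolding is_norm_def by auto

lemma nrm_zero [simp]: "nrm E 0 = 0"
  by simp

lemma nrm_minus: "nrm E (- x) = nrm E x"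
  using nrm_scaleR[of E "-1" x] by simp

lemma nrm_pos: "x \<noteq> 0 \<Longrightarrow> 0 < nrm E x"
  by (metis nrm_eq_0 nrm_nonneg order_less_le)

lemma nrm_sum: "finite A \<Longrightarrow> nrm E (sum f A) \<le> (\<Sum>i\<in>A. nrm E (f i))"
proof (induction A rule: finite_induct)
  case (insert a A)
  then show ?case using nrm_triangle[of E "f a" "sum f A"] by simp
qed simp

lemma nrm_upper: "\<exists>C>0. \<forall>x. nrm E x \<le> C * norm x"
proof -
  define C where "C = (\<Sum>i\<in>UNIV. nrm E (axis i 1)) + 1"
  have "nrm E x \<le> C * norm x" for x
  proof -
    have "nrm E x = nrm E (\<Sum>i\<in>UNIV. (x $ i) *\<^sub>R axis i 1)"
      by (simp add: basis_expansion[of x, unfolded scalar_mult_eq_scaleR])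
    also have "\<dots> \<le> (\<Sum>i\<in>UNIV. nrm E ((x $ i) *\<^sub>R axis i 1))"
      by (rule nrm_sum) simp
    also have "\<dots> \<le> (\<Sum>i\<in>UNIV. norm x * nrm E (axis i 1))"
      by (intro sum_mono) (simp add: nrm_scaleR mult_right_mono component_le_norm_cart)
    also have "\<dots> \<le> C * norm x"
      by (simp add: C_def sum_distrib_left[symmetric] algebra_simps)
    finally show ?thesis .
  qed
  moreover have "C > 0" unfolding C_def
    by (simp add: add_nonneg_pos sum_nonneg)
  ultimately show ?thesis by blast
qed

lemma nrm_diff: "\<bar>nrm E x - nrm E y\<bar> \<le> nrm E (x - y)"
  using nrm_triangle[of E "x - y" y] nrm_triangle[of E "y - x" x] nrm_minus[of E "x - y"] by simp

lemma continuous_nrm: "continuous_on S (nrm E)"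
proof -
  obtain C where C: "C > 0" "\<And>x. nrm E x \<le> C * norm x" using nrm_upper by blast
  have "\<bar>nrm E x - nrm E y\<bar> \<le> C * norm (x - y)" for x y
    using nrm_diff C(2) by (rule order_trans)
  then have "C-lipschitz_on S (nrm E)"
    using C(1) by (intro lipschitz_onI) (auto simp: dist_real_def dist_norm)
  then show ?thesis by (rule lipschitz_on_continuous_on)
qed

lemma nrm_lower: "\<exists>c>0. \<forall>x. c * norm x \<le> nrm E x"
proof -
  have "sphere (0 :: real ^ 'n) 1 \<noteq> {}" by simp
  then obtain u where u: "u \<in> sphere 0 1" "\<And>y. y \<in> sphere 0 1 \<Longrightarrow> nrm E u \<le> nrm E y"
    using continuous_attains_inf[OF compact_sphere _ continuous_nrm[of _ E]] by metis
  have "nrm E u * norm x \<le> nrm E x" for x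
  proof (cases "x = 0")
    case False
    then have "nrm E u \<le> nrm E ((1 / norm x) *\<^sub>R x)" by (intro u(2)) simp
    with False show ?thesis by (simp add: nrm_scaleR field_simps)
  qed simp
  moreover have "nrm E u > 0" using u(1) by (intro nrm_pos) auto
  ultimately show ?thesis by blast
qed

lemma op_norm_bdd_above:
  assumes "linear T"
  shows "bdd_above {nrm F (T x) | x. nrm E x \<le> 1}"
proof -
  obtain c where c: "c > 0" "\<And>x. c * norm x \<le> nrm E x" using nrm_lower by blast
  obtain C where C: "C > 0" "\<And>x. nrm F x \<le> C * norm x" using nrm_upper by blast
  obtain B where B: "B > 0" "\<And>x. norm (T x) \<le> B * norm x"
    using linear_bounded_pos[OF assms] by blast
  have "nrm F (T x) \<le> C * (B * (1 / c))" if "nrm E x \<le> 1" for x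
  proof -
    have "norm x \<le> 1 / c" using c that by (smt (verit) mult.commute pos_le_divide_eq)
    then have "norm (T x) \<le> B * (1 / c)" using B by (meson mult_left_mono less_imp_le order_trans)
    then show ?thesis using C by (meson mult_left_mono less_imp_le order_trans)
  qed
  then show ?thesis by (auto intro!: bdd_aboveI)
qed

lemma op_norm_nonneg: "linear T \<Longrightarrow> 0 \<le> op_norm E F T"
  unfolding op_norm_def
  by (rule cSup_upper2[OF _ _ op_norm_bdd_above]) (auto intro: exI[of _ 0])

lemma op_norm_bound:
  assumes "linear T"
  shows "nrm F (T x) \<le> op_norm E F T * nrm E x"
proof (cases "x = 0")
  case True
  then show ?thesis using linear_0[OF assms] by simp
next
  case False
  let ?r = "nrm E x"
  have r: "?r > 0" using False by (rule nrm_pos)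
  have "nrm F (T ((1 / ?r) *\<^sub>R x)) \<le> op_norm E F T"
    unfolding op_norm_def
    by (rule cSup_upper[OF _ op_norm_bdd_above[OF assms]])
       (use r in \<open>auto simp: nrm_scaleR intro!: exI[of _ "(1 / ?r) *\<^sub>R x"]\<close>)
  then show ?thesis using r by (simp add: linear_scale[OF assms] nrm_scaleR field_simps)
qed

lemma op_norm_least:
  assumes "\<And>x. nrm F (T x) \<le> c * nrm E x" "0 \<le> c"
  shows "op_norm E F T \<le> c"
  unfolding op_norm_def
proof (rule cSup_least)
  show "{nrm F (T x) | x. nrm E x \<le> 1} \<noteq> {}" by (auto intro: exI[of _ 0])
  fix y assume "y \<in> {nrm F (T x) | x. nrm E x \<le> 1}"
  then obtain x where x: "y = nrm F (T x)" "nrm E x \<le> 1" by blast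
  then show "y \<le> c"
    using assms(1)[of x] mult_left_mono[OF x(2) assms(2)] by simp
qed

lemma linear_inv_bij:
  fixes T :: "'a::real_vector \<Rightarrow> 'b::real_vector"
  assumes "linear T" "bij T"
  shows "linear (inv T)"
proof (rule linearI)
  have s: "T (inv T z) = z" for z using assms(2) by (simp add: bij_is_surj surj_f_inv_f)
  have i: "inj T" using assms(2) by (rule bij_is_inj)
  show "inv T (x + y) = inv T x + inv T y" for x y
    by (rule injD[OF i]) (simp add: s linear_add[OF assms(1)])
  show "inv T (c *\<^sub>R x) = c *\<^sub>R inv T x" for c x
    by (rule injD[OF i]) (simp add: s linear_scale[OF assms(1)])
qed

lemma isomorphism_ge_1:
  fixes T :: "real ^ 'n::finite \<Rightarrow> real ^ 'n"
  assumes "linear T" "bij T"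
  shows "1 \<le> op_norm E F T * op_norm F E (inv T)"
proof -
  define x :: "real ^ 'n" where "x = 1"
  have x: "nrm E x > 0" by (rule nrm_pos) (simp add: x_def)
  have "inv T (T x) = x" using assms(2) by (simp add: bij_is_inj)
  then have "nrm E x \<le> op_norm F E (inv T) * nrm F (T x)"
    using op_norm_bound[OF linear_inv_bij[OF assms], of E "T x" F] by simp
  also have "\<dots> \<le> op_norm F E (inv T) * (op_norm E F T * nrm E x)"
    using op_norm_bound[OF assms(1)] op_norm_nonneg[OF linear_inv_bij[OF assms]]
    by (rule mult_left_mono)
  finally have "1 * nrm E x \<le> (op_norm E F T * op_norm F E (inv T)) * nrm E x"
    by (simp add: mult_ac)
  then show ?thesis using x by (rule mult_right_le_imp_le)
qed

lemma bm_bdd_below: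
  "bdd_below {op_norm E F T * op_norm F E (inv T) | T. linear T \<and> bij T}"
  by (rule bdd_belowI[of _ 1]) (auto intro: isomorphism_ge_1)

lemma bm_nonempty:
  "{op_norm E F T * op_norm F E (inv T) | T. linear T \<and> bij T} \<noteq> {}"
  using linear_id bij_id by blast

lemma banach_mazur_le:
  "linear T \<Longrightarrow> bij T \<Longrightarrow> banach_mazur E F \<le> op_norm E F T * op_norm F E (inv T)"
  unfolding banach_mazur_def by (rule cInf_lower[OF _ bm_bdd_below]) blast

lemma banach_mazur_ge_1: "1 \<le> banach_mazur E F"
  unfolding banach_mazur_def
  by (rule cInf_greatest[OF bm_nonempty]) (auto intro: isomorphism_ge_1)

lemma banach_mazur_approx:
  assumes "banach_mazur E F < c"
  obtains T where "linear T" "bij T" "op_norm E F T * op_norm F E (inv T) < c"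
  using assms unfolding banach_mazur_def
  by (subst (asm) cInf_less_iff[OF bm_nonempty bm_bdd_below]) blast

lemma banach_mazur_commute:
  fixes E F :: "'n::finite normed_space"
  shows "banach_mazur E F = banach_mazur F E"
proof -
  have le: "banach_mazur E F \<le> banach_mazur F E" for E F :: "'n normed_space"
    unfolding banach_mazur_def[of F E]
  proof (rule cInf_greatest[OF bm_nonempty], clarify)
    fix T :: "real ^ 'n \<Rightarrow> real ^ 'n"
    assume T: "linear T" "bij T"
    have "banach_mazur E F \<le> op_norm E F (inv T) * op_norm F E (inv (inv T))"
      by (rule banach_mazur_le) (auto simp: T linear_inv_bij bij_imp_bij_inv)
    then show "banach_mazur E F \<le> op_norm F E T * op_norm E F (inv T)"
      by (simp add: inv_inv_eq T mult.commute)
  qed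
  show ?thesis using le[of E F] le[of F E] by simp
qed

lemma op_norm_comp:
  assumes "linear S" "linear T"
  shows "op_norm E G (S \<circ> T) \<le> op_norm F G S * op_norm E F T"
proof (rule op_norm_least)
  fix x
  have "nrm G (S (T x)) \<le> op_norm F G S * nrm F (T x)" using assms(1) by (rule op_norm_bound)
  also have "\<dots> \<le> op_norm F G S * (op_norm E F T * nrm E x)"
    using op_norm_bound[OF assms(2)] op_norm_nonneg[OF assms(1)] by (rule mult_left_mono)
  finally show "nrm G ((S \<circ> T) x) \<le> op_norm F G S * op_norm E F T * nrm E x"
    by (simp add: mult_ac)
qed (simp add: op_norm_nonneg assms)

lemma banach_mazur_triangle: "banach_mazur E G \<le> banach_mazur E F * banach_mazur F G"
proof -
  have *: "banach_mazur E G \<le> a * b" if a: "banach_mazur E F < a" and b: "banach_mazur F G < b" for a b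
  proof -
    obtain T where T: "linear T" "bij T" "op_norm E F T * op_norm F E (inv T) < a"
      using a by (rule banach_mazur_approx)
    obtain S where S: "linear S" "bij S" "op_norm F G S * op_norm G F (inv S) < b"
      using b by (rule banach_mazur_approx)
    have lin: "linear (inv T)" "linear (inv S)" using T S by (auto intro: linear_inv_bij)
    have "banach_mazur E G \<le> op_norm E G (S \<circ> T) * op_norm G E (inv (S \<circ> T))"
      using T S by (intro banach_mazur_le linear_compose bij_comp)
    also have "inv (S \<circ> T) = inv T \<circ> inv S" using T S by (intro o_inv_distrib)
    also have "op_norm E G (S \<circ> T) * op_norm G E (inv T \<circ> inv S)
        \<le> (op_norm F G S * op_norm E F T) * (op_norm F E (inv T) * op_norm G F (inv S))"
      using T S lin by (intro mult_mono op_norm_comp mult_nonneg_nonneg op_norm_nonneg linear_compose)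
    also have "\<dots> = (op_norm E F T * op_norm F E (inv T)) * (op_norm F G S * op_norm G F (inv S))"
      by (simp add: mult_ac)
    also have "\<dots> \<le> a * b"
      using T S lin isomorphism_ge_1[OF T(1,2), of E F]
      by (intro mult_mono mult_nonneg_nonneg op_norm_nonneg) auto
    finally show ?thesis .
  qed
  let ?a = "banach_mazur E F" and ?b = "banach_mazur F G"
  have lim: "((\<lambda>e. (?a + e) * (?b + e)) \<longlongrightarrow> (?a + 0) * (?b + 0)) (at_right 0)"
    by (intro tendsto_intros)
  have ev: "eventually (\<lambda>e. banach_mazur E G \<le> (?a + e) * (?b + e)) (at_right 0)"
    using eventually_at_right_less[of "0::real"] by eventually_elim (rule *; simp)
  show ?thesis
    using tendsto_lowerbound[OF lim ev] by simp
qed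

lemma isometric_imp_banach_mazur:
  assumes "isometric E F"
  shows "banach_mazur E F = 1"
proof -
  obtain T where T: "linear T" "bij T" "\<And>x. nrm F (T x) = nrm E x"
    using assms unfolding isometric_def by blast
  have "nrm E (inv T y) = nrm F y" for y
    using T(3)[of "inv T y"] T(2) by (simp add: bij_is_surj surj_f_inv_f)
  then have "op_norm F E (inv T) \<le> 1" "op_norm E F T \<le> 1"
    using T(3) by (auto intro!: op_norm_least)
  then have "op_norm E F T * op_norm F E (inv T) \<le> 1"
    by (intro mult_le_one op_norm_nonneg linear_inv_bij T)
  then show ?thesis
    using banach_mazur_le[OF T(1,2), of E F] banach_mazur_ge_1[of E F] by simp
qed

lemma banach_mazur_imp_isometric:
  fixes E F :: "'n::finite normed_space"
  assumes "banach_mazur E F = 1"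
  shows "isometric E F"
proof -
  have "\<exists>S :: real ^ 'n \<Rightarrow> real ^ 'n. linear S \<and> (\<forall>x. nrm F (S x) \<le> nrm E x) \<and>
          (\<forall>x. nrm E x \<le> (1 + 1 / real (Suc k)) * nrm F (S x))" for k
  proof -
    have "banach_mazur E F < 1 + 1 / real (Suc k)" using assms by simp
    then obtain T where T: "linear T" "bij T"
        "op_norm E F T * op_norm F E (inv T) < 1 + 1 / real (Suc k)"
      by (rule banach_mazur_approx)
    let ?c = "op_norm E F T"
    have c0: "?c \<noteq> 0" using isomorphism_ge_1[OF T(1,2), of E F] by auto
    then have c: "?c > 0" using op_norm_nonneg[OF T(1), of E F] by simp
    let ?S = "\<lambda>x. (1 / ?c) *\<^sub>R T x"
    have "linear ?S" using T(1) by (rule linear_compose_scale_right)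
    moreover have "nrm F (?S x) \<le> nrm E x" for x
      using op_norm_bound[OF T(1), of F x E] c by (simp add: nrm_scaleR field_simps)
    moreover have "nrm E x \<le> (1 + 1 / real (Suc k)) * nrm F (?S x)" for x
    proof -
      have "nrm E x \<le> op_norm F E (inv T) * nrm F (T x)"
        using op_norm_bound[OF linear_inv_bij[OF T(1,2)], of E "T x" F] T(2)
        by (simp add: bij_is_inj)
      also have "nrm F (T x) = ?c * nrm F (?S x)" using c by (simp add: nrm_scaleR)
      also have "op_norm F E (inv T) * (?c * nrm F (?S x))
          = (?c * op_norm F E (inv T)) * nrm F (?S x)" by (simp only: mult_ac)
      also have "\<dots> \<le> (1 + 1 / real (Suc k)) * nrm F (?S x)"
        using T(3) by (intro mult_right_mono) auto
      finally show ?thesis .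
    qed
    ultimately show ?thesis by blast
  qed
  then obtain S :: "nat \<Rightarrow> real ^ 'n \<Rightarrow> real ^ 'n" where
    S: "\<And>k. linear (S k)" "\<And>k x. nrm F (S k x) \<le> nrm E x"
       "\<And>k x. nrm E x \<le> (1 + 1 / real (Suc k)) * nrm F (S k x)"
    by metis
  obtain C where C: "C > 0" "\<And>x. nrm E x \<le> C * norm x" using nrm_upper by blast
  obtain c where c: "c > 0" "\<And>x. c * norm x \<le> nrm F x" using nrm_lower by blast
  have "norm (matrix (S k)) \<le> (\<Sum>i\<in>(UNIV::'n set). \<Sum>j\<in>(UNIV::'n set). C / c)" for k
  proof -
    have "\<bar>matrix (S k) $ i $ j\<bar> \<le> C / c" for i j
    proof -
      have "\<bar>matrix (S k) $ i $ j\<bar> \<le> norm (S k (axis j 1))"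
        by (simp add: matrix_def component_le_norm_cart)
      moreover have "c * norm (S k (axis j 1)) \<le> C * norm (axis j (1::real))"
        using c(2) S(2) C(2) by (meson order_trans)
      ultimately show ?thesis using c(1)
        by (simp add: field_simps) (meson mult_left_mono less_imp_le order_trans)
    qed
    then have "norm (matrix (S k) $ i) \<le> (\<Sum>j\<in>(UNIV::'n set). C / c)" for i
      using norm_le_l1_cart[of "matrix (S k) $ i"] by (meson order_trans sum_mono)
    moreover have "norm (matrix (S k)) \<le> (\<Sum>i\<in>UNIV. norm (matrix (S k) $ i))"
      unfolding norm_vec_def by (rule L2_set_le_sum) simp
    ultimately show ?thesis by (meson order_trans sum_mono)
  qed
  then have "bounded (range (\<lambda>k. matrix (S k)))" by (auto simp: bounded_iff)
  then obtain A r where r: "strict_mono (r :: nat \<Rightarrow> nat)"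
      and A: "((\<lambda>k. matrix (S k)) \<circ> r) \<longlonglongrightarrow> A"
    using bounded_imp_convergent_subsequence by blast
  have lim: "(\<lambda>k. S (r k) x) \<longlonglongrightarrow> A *v x" for x
  proof -
    have "(\<lambda>k. matrix (S (r k)) *v x) \<longlonglongrightarrow> A *v x"
      using A unfolding o_def matrix_vector_mult_def
      by (intro vec_tendstoI) (auto intro!: tendsto_intros)
    then show ?thesis by (simp add: matrix_works[OF S(1)[folded linear_matrix_vector_mul_eq]])
  qed
  have limF: "(\<lambda>k. nrm F (S (r k) x)) \<longlonglongrightarrow> nrm F (A *v x)" for x
    using continuous_on_tendsto_compose[OF continuous_nrm[of UNIV F] lim] by simp
  have iso: "nrm F (A *v x) = nrm E x" for x
  proof (rule antisym)
    show "nrm F (A *v x) \<le> nrm E x"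
      by (rule LIMSEQ_le_const2[OF limF]) (use S(2) in blast)
    have "(\<lambda>k. 1 + 1 / real (Suc (r k))) \<longlonglongrightarrow> 1 + 0"
      by (intro tendsto_add tendsto_const)
         (use LIMSEQ_subseq_LIMSEQ[OF LIMSEQ_Suc[OF lim_1_over_n] r] in \<open>simp add: o_def\<close>)
    then have "(\<lambda>k. (1 + 1 / real (Suc (r k))) * nrm F (S (r k) x)) \<longlonglongrightarrow> (1 + 0) * nrm F (A *v x)"
      using limF by (rule tendsto_mult)
    then have "nrm E x \<le> (1 + 0) * nrm F (A *v x)"
      by (rule LIMSEQ_le_const) (use S(3) in blast)
    then show "nrm E x \<le> nrm F (A *v x)" by simp
  qed
  have inj: "inj ((*v) A)"
    unfolding linear_injective_0[OF matrix_vector_mul_linear] using iso nrm_eq_0 by metis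
  then have "bij ((*v) A)"
    by (simp add: bij_def linear_injective_imp_surjective)
  then show ?thesis
    unfolding isometric_def using iso matrix_vector_mul_linear by blast
qed

lemma banach_mazur_eq_1_iff: "banach_mazur E F = 1 \<longleftrightarrow> isometric E F"
  using isometric_imp_banach_mazur banach_mazur_imp_isometric by blast

lemma normed_space_representation:
  assumes "dim (UNIV :: 'a::real_normed_vector set) = CARD('n::finite)"
  shows "\<exists>(E :: 'n normed_space) (T :: real ^ 'n \<Rightarrow> 'a).
           linear T \<and> bij T \<and> (\<forall>x. norm (T x) = nrm E x)"
proof -
  obtain B :: "'a set" where B: "independent B" "UNIV \<subseteq> span B" "card B = dim (UNIV :: 'a set)"
    using basis_exists[of "UNIV :: 'a set"] by metis
  have fin: "finite B" using B(3) assms by (simp add: card_ge_0_finite)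
  obtain f :: "'n \<Rightarrow> 'a" where f: "bij_betw f UNIV B"
    using finite_same_card_bij[of "UNIV :: 'n set" B] fin B(3) assms by auto
  define T :: "real ^ 'n \<Rightarrow> 'a" where "T = (\<lambda>v. \<Sum>i\<in>UNIV. (v $ i) *\<^sub>R f i)"
  have lin: "linear T"
    by (rule linearI) (simp_all add: T_def scaleR_left_distrib sum.distrib scaleR_sum_right)
  have reindex: "(\<Sum>b\<in>B. g b) = (\<Sum>i\<in>UNIV. g (f i))" for g :: "'a \<Rightarrow> 'a"
    using sum.reindex_bij_betw[OF f, of g] by simp
  have inj_f: "inj f" using f by (simp add: bij_betw_def)
  have "v = 0" if "T v = 0" for v
  proof -
    have z: "(\<Sum>b\<in>B. (v $ (inv f b)) *\<^sub>R b) = 0"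
      using that by (simp add: reindex T_def inv_f_f[OF inj_f])
    have "v $ i = 0" for i
      using independentD[OF B(1) fin subset_refl z, of "f i"] bij_betwE[OF f]
      by (simp add: inv_f_f[OF inj_f])
    then show ?thesis by (simp add: vec_eq_iff)
  qed
  then have inj: "inj T" using linear_injective_0[OF lin] by blast
  have "surj T"
  proof -
    have "\<exists>v. y = T v" for y
    proof -
      have "y \<in> span B" using B(2) by blast
      then obtain u where u: "y = (\<Sum>b\<in>B. u b *\<^sub>R b)"
        using span_finite[OF fin] by auto
      then have "y = T (\<chi> i. u (f i))" by (simp add: T_def reindex)
      then show ?thesis by blast
    qed
    then show ?thesis by (simp add: surj_def)
  qed
  with inj have bij: "bij T" by (simp add: bij_def)
  have "is_norm (\<lambda>x. norm (T x))"
    using inj linear_injective_0[OF lin] unfolding is_norm_def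
    by (auto simp: linear_add[OF lin] linear_scale[OF lin] linear_0[OF lin] norm_triangle_ineq)
  then have "nrm (normed_space_of (\<lambda>x. norm (T x))) = (\<lambda>x. norm (T x))"
    by (simp add: normed_space_of_inverse)
  then show ?thesis using lin bij by metis
qed

quotient_type (overloaded) 'n BM = "'n::finite normed_space" / isometric
  morphisms BM_rep isometry_class
proof (rule equivpI)
  show "reflp (isometric :: 'n normed_space \<Rightarrow> _)"
    unfolding reflp_def isometric_def by (auto intro!: exI[of _ id] linear_id)
  show "symp (isometric :: 'n normed_space \<Rightarrow> _)"
    by (rule sympI) (simp add: banach_mazur_eq_1_iff[symmetric] banach_mazur_commute)
  show "transp (isometric :: 'n normed_space \<Rightarrow> _)"
  proof (rule transpI)
    fix E F G :: "'n normed_space"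
    assume "isometric E F" "isometric F G"
    then show "isometric E G"
      using banach_mazur_triangle[of E G F] banach_mazur_ge_1[of E G]
      by (simp add: banach_mazur_eq_1_iff[symmetric])
  qed
qed

instantiation BM :: (finite) metric_space
begin

lift_definition dist_BM :: "'a BM \<Rightarrow> 'a BM \<Rightarrow> real" is "\<lambda>E F. ln (banach_mazur E F)"
proof -
  fix E E' F F' :: "'a normed_space"
  assume "isometric E E'" "isometric F F'"
  then have 1: "banach_mazur E E' = 1" "banach_mazur E' E = 1"
      "banach_mazur F F' = 1" "banach_mazur F' F = 1"
    by (simp_all add: banach_mazur_eq_1_iff[symmetric] banach_mazur_commute)
  have "banach_mazur E F = banach_mazur E' F'"
    using banach_mazur_triangle[of E F E'] banach_mazur_triangle[of E' F F']
      banach_mazur_triangle[of E' F' E] banach_mazur_triangle[of E F' F] 1 by simp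
  then show "ln (banach_mazur E F) = ln (banach_mazur E' F')" by simp
qed

definition uniformity_BM :: "('a BM \<times> 'a BM) filter" where
  "uniformity_BM = (INF e\<in>{0 <..}. principal {(x, y). dist x y < e})"

definition open_BM :: "'a BM set \<Rightarrow> bool" where
  "open_BM U \<longleftrightarrow> (\<forall>x\<in>U. eventually (\<lambda>(x', y). x' = x \<longrightarrow> y \<in> U) uniformity)"

instance
proof
  show "uniformity = (INF e\<in>{0 <..}. principal {(x :: 'a BM, y). dist x y < e})"
    by (rule uniformity_BM_def)
  show "open U \<longleftrightarrow> (\<forall>x\<in>U. eventually (\<lambda>(x', y). x' = x \<longrightarrow> y \<in> U) uniformity)" for U :: "'a BM set"
    by (rule open_BM_def)
  show "dist x y = 0 \<longleftrightarrow> x = y" for x y :: "'a BM"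
  proof transfer
    fix E F :: "'a normed_space"
    show "ln (banach_mazur E F) = 0 \<longleftrightarrow> isometric E F"
      using banach_mazur_ge_1[of E F] by (simp add: banach_mazur_eq_1_iff[symmetric])
  qed
  show "dist x y \<le> dist x z + dist y z" for x y z :: "'a BM"
  proof transfer
    fix E F G :: "'a normed_space"
    have pos: "banach_mazur E F > 0" "banach_mazur E G > 0" "banach_mazur G F > 0"
      using banach_mazur_ge_1 by (meson less_le_trans zero_less_one)+
    have "ln (banach_mazur E F) \<le> ln (banach_mazur E G * banach_mazur G F)"
      using pos banach_mazur_triangle by (subst ln_le_cancel_iff) auto
    then show "ln (banach_mazur E F) \<le> ln (banach_mazur E G) + ln (banach_mazur F G)"
      using pos by (simp add: ln_mult banach_mazur_commute[of F G])
  qed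
qed

end

text \<open>A partition \<open>a = t 0 \<le> \<dots> \<le> t m = b\<close>
  is encoded as a pair \<open>(m, t)\<close>; values of \<open>t\<close> beyond \<open>m\<close> are irrelevant. The length may be infinite.\<close>

definition path_length :: "(real \<Rightarrow> 'a::metric_space) \<Rightarrow> real \<Rightarrow> real \<Rightarrow> ereal" where
  "path_length \<gamma> a b =
     (SUP (m, t) \<in> {(m :: nat, t :: nat \<Rightarrow> real). t 0 = a \<and> t m = b \<and> (\<forall>i<m. t i \<le> t (Suc i))}.
        ereal (\<Sum>i=1..m. dist (\<gamma> (t i)) (\<gamma> (t (i - 1)))))"

definition geodesic ::
    "(real \<Rightarrow> 'a::metric_space) \<Rightarrow> real \<Rightarrow> real \<Rightarrow> 'a \<Rightarrow> 'a \<Rightarrow> bool" where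
  "geodesic \<gamma> a b x y \<longleftrightarrow>
     a \<le> b \<and> continuous_on {a..b} \<gamma> \<and> \<gamma> a = x \<and> \<gamma> b = y \<and>
     path_length \<gamma> a b = ereal (dist x y)"

definition geodesic_traces :: "'a::metric_space \<Rightarrow> 'a \<Rightarrow> 'a set set" where
  "geodesic_traces x y = {\<gamma> ` {a..b} | \<gamma> a b. geodesic \<gamma> a b x y}"

end

theory Submission
  imports Defs
begin

text \<open>Replacing \<open>F\<close> by an isometric copy \<open>M\<close> in optimal position, the norms satisfy
  \<open>E \<le> M \<le> d E\<close>, where \<open>d\<close> is the Banach-Mazur distance and both inequalities are attained. Put
  \<open>\<kappa> = sqrt d\<close>. Every norm \<open>K\<close> with \<open>P = max E (M / \<kappa>) \<le> K \<le> Q = (\<kappa> E + M) / (\<kappa> + 1)\<close> satisfies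
  \<open>E \<le> K \<le> \<kappa> E\<close> and \<open>K \<le> M \<le> \<kappa> K\<close>, hence is the midpoint of a geodesic, and the trace of a geodesic
  contains only one midpoint. It remains to find uncountably many isometry classes between \<open>P\<close> and \<open>Q\<close>.
  Since \<open>P / Q\<close> is not constant, the norms between \<open>P\<close> and \<open>Q\<close> contain a cube with \<open>n\<^sup>2 + 1\<close>
  parameters that can be read off from the values at \<open>n\<^sup>2 + 1\<close> points. The norms of the cube
  isometric to a given one are parametrised in a Lipschitz way by matrices, so they correspond to a
  null set of parameters, and countably many null sets do not cover the cube.\<close>

section \<open>Construction of norms and bounds on the Banach-Mazur distance\<close>

lemma nrm_normed_space_of: "is_norm N \<Longrightarrow> nrm (normed_space_of N) = N"
  by (simp add: normed_space_of_inverse)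

lemma is_norm_lincomb:
  assumes "is_norm N" "is_norm M" "0 \<le> a" "0 < b"
  shows "is_norm (\<lambda>x. a * N x + b * M x)"
  unfolding is_norm_def
proof (intro conjI allI)
  fix x y c
  have *: "0 \<le> a * N x" "0 \<le> b * M x" using assms by (auto simp: is_norm_def)
  then show "0 \<le> a * N x + b * M x" by simp
  show "(a * N x + b * M x = 0) = (x = 0)"
  proof
    assume "a * N x + b * M x = 0"
    with * have "b * M x = 0" by linarith
    then show "x = 0" using assms by (simp add: is_norm_def)
  next
    assume "x = 0"
    then have "N x = 0" "M x = 0" using assms by (auto simp: is_norm_def)
    then show "a * N x + b * M x = 0" by simp
  qed
  show "a * N (c *\<^sub>R x) + b * M (c *\<^sub>R x) = \<bar>c\<bar> * (a * N x + b * M x)"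
    using assms by (simp add: is_norm_def algebra_simps)
  have "N (x + y) \<le> N x + N y" "M (x + y) \<le> M x + M y"
    using assms by (auto simp: is_norm_def)
  then have "a * N (x + y) \<le> a * (N x + N y)" "b * M (x + y) \<le> b * (M x + M y)"
    using assms by (auto intro: mult_left_mono)
  then show "a * N (x + y) + b * M (x + y) \<le> a * N x + b * M x + (a * N y + b * M y)"
    by (simp add: algebra_simps)
qed

lemma is_norm_scale: "is_norm N \<Longrightarrow> 0 < b \<Longrightarrow> is_norm (\<lambda>x. b * N x)"
  using is_norm_lincomb[of N N 0 b] by simp

lemma is_norm_max:
  assumes "is_norm N" "is_norm M"
  shows "is_norm (\<lambda>x. max (N x) (M x))"
  unfolding is_norm_def
proof (intro conjI allI)
  fix x y c
  have *: "0 \<le> N x" "N x = 0 \<longleftrightarrow> x = 0" "M x = 0 \<longleftrightarrow> x = 0" "0 \<le> M x"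
      "N (x + y) \<le> N x + N y" "M (x + y) \<le> M x + M y"
    using assms by (auto simp: is_norm_def)
  then show "0 \<le> max (N x) (M x)" "max (N x) (M x) = 0 \<longleftrightarrow> x = 0"
      "max (N (x + y)) (M (x + y)) \<le> max (N x) (M x) + max (N y) (M y)"
    by linarith+
  show "max (N (c *\<^sub>R x)) (M (c *\<^sub>R x)) = \<bar>c\<bar> * max (N x) (M x)"
    using assms by (simp add: is_norm_def max_mult_distrib_left)
qed

lemma is_norm_Max:
  assumes "finite I" "I \<noteq> {}" "\<And>i. i \<in> I \<Longrightarrow> is_norm (N i)"
  shows "is_norm (\<lambda>x. MAX i\<in>I. N i x)"
  using assms
proof (induction I rule: finite_ne_induct)
  case (singleton i)
  then show ?case by simp
next
  case (insert i I)
  then have "is_norm (\<lambda>x. max (N i x) (MAX i\<in>I. N i x))" by (intro is_norm_max) auto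
  then show ?case using insert by simp
qed

text \<open>The identity serves as the isomorphism, so comparing two norms pointwise on the same
  \<open>real ^ 'n\<close> bounds their distance.\<close>

lemma banach_mazur_le_bounds:
  assumes "\<And>x. nrm F x \<le> b * nrm E x" "\<And>x. nrm E x \<le> c * nrm F x" "0 \<le> b" "0 \<le> c"
  shows "banach_mazur E F \<le> b * c"
proof -
  have "banach_mazur E F \<le> op_norm E F id * op_norm F E (inv id)"
    by (rule banach_mazur_le) (auto simp: linear_id)
  also have "\<dots> \<le> b * c"
    using assms by (intro mult_mono op_norm_least) (auto simp: op_norm_nonneg linear_id)
  finally show ?thesis .
qed

lemma dist_isometry_class:
  "dist (isometry_class E) (isometry_class F) = ln (banach_mazur E F)"
  by (simp add: dist_BM.abs_eq)

section \<open>Optimal position and contact points\<close>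

text \<open>The infimum defining \<open>banach_mazur E F\<close> is attained by compactness: the
  matrices that are optimal up to \<open>1 / real (Suc k)\<close> form a decreasing sequence of
  nonempty compact sets, and \<open>nrm G\<close> is \<open>nrm F\<close> composed with a multiple
  of a common element.\<close>

lemma optimal_position:
  fixes E F :: "'n::finite normed_space"
  obtains G where "isometric G F" "\<And>x. nrm E x \<le> nrm G x"
    "\<And>x. nrm G x \<le> banach_mazur E F * nrm E x"
proof -
  let ?d = "banach_mazur E F"
  define S where "S k = {A :: real ^ 'n ^ 'n. \<forall>x. nrm F (A *v x) \<le> nrm E x \<and>
      nrm E x \<le> (?d + 1 / real (Suc k)) * nrm F (A *v x)}" for k
  obtain C where C: "C > 0" "\<And>x. nrm E x \<le> C * norm x" using nrm_upper by blast
  obtain c where c: "c > 0" "\<And>x. c * norm x \<le> nrm F x" using nrm_lower by blast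
  have bounded: "bounded (S k)" for k
  proof -
    have "norm A \<le> (\<Sum>i\<in>(UNIV::'n set). \<Sum>j\<in>(UNIV::'n set). C / c)" if "A \<in> S k" for A
    proof -
      have "\<bar>A $ i $ j\<bar> \<le> C / c" for i j
      proof -
        have "\<bar>A $ i $ j\<bar> = \<bar>(A *v axis j 1) $ i\<bar>"
          by (simp add: matrix_vector_mul_component inner_axis)
        also have "\<dots> \<le> norm (A *v axis j 1)" by (rule component_le_norm_cart)
        finally have "c * \<bar>A $ i $ j\<bar> \<le> c * norm (A *v axis j 1)" using c(1) by simp
        also have "\<dots> \<le> nrm F (A *v axis j 1)" by (rule c(2))
        also have "\<dots> \<le> nrm E (axis j 1)" using that by (simp add: S_def)
        also have "\<dots> \<le> C * norm (axis j (1::real))" by (rule C(2))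
        finally show ?thesis using c(1) by (simp add: field_simps)
      qed
      then have "norm (A $ i) \<le> (\<Sum>j\<in>(UNIV::'n set). C / c)" for i
        using norm_le_l1_cart[of "A $ i"] by (meson order_trans sum_mono)
      moreover have "norm A \<le> (\<Sum>i\<in>UNIV. norm (A $ i))"
        unfolding norm_vec_def by (rule L2_set_le_sum) simp
      ultimately show ?thesis by (meson order_trans sum_mono)
    qed
    then show ?thesis by (auto simp: bounded_iff)
  qed
  have cont: "continuous_on UNIV (\<lambda>A :: real ^ 'n ^ 'n. nrm F (A *v x))" for x
    by (rule continuous_on_compose2[OF continuous_nrm[of UNIV F]])
      (auto simp: matrix_vector_mult_def intro!: continuous_intros)
  have "closed (S k)" for k
    unfolding S_def
    by (intro closed_Collect_all closed_Collect_conj closed_Collect_le continuous_intros cont)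
  then have compact: "compact (S k)" for k
    using bounded by (simp add: compact_eq_bounded_closed)
  have nonempty: "S k \<noteq> {}" for k
  proof -
    have "?d < ?d + 1 / real (Suc k)" by simp
    then obtain T where T: "linear T" "bij T"
        "op_norm E F T * op_norm F E (inv T) < ?d + 1 / real (Suc k)"
      by (rule banach_mazur_approx)
    let ?c = "op_norm E F T"
    \<comment> \<open>The product of the two operator norms is at least 1, so \<open>?c\<close>
      cannot vanish and \<open>T\<close> can be rescaled to a contraction.\<close>
    have "?c \<noteq> 0" using isomorphism_ge_1[OF T(1,2), of E F] by auto
    then have c: "?c > 0" using op_norm_nonneg[OF T(1), of E F] by simp
    let ?A = "(1 / ?c) *\<^sub>R matrix T"
    have A: "?A *v x = (1 / ?c) *\<^sub>R T x" for x
      using matrix_works[OF T(1)[folded linear_matrix_vector_mul_eq]]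
      by (simp add: scaleR_matrix_vector_assoc[symmetric])
    have "nrm F (?A *v x) \<le> nrm E x" for x
      using op_norm_bound[OF T(1), of F x E] c by (simp add: A nrm_scaleR field_simps)
    moreover have "nrm E x \<le> (?d + 1 / real (Suc k)) * nrm F (?A *v x)" for x
    proof -
      have "nrm E x \<le> op_norm F E (inv T) * nrm F (T x)"
        using op_norm_bound[OF linear_inv_bij[OF T(1,2)], of E "T x" F] T(2)
        by (simp add: bij_is_inj)
      also have "\<dots> = (?c * op_norm F E (inv T)) * nrm F (?A *v x)"
        using c by (simp add: A nrm_scaleR)
      also have "\<dots> \<le> (?d + 1 / real (Suc k)) * nrm F (?A *v x)"
        using T(3) by (intro mult_right_mono) auto
      finally show ?thesis .
    qed
    ultimately have "?A \<in> S k" by (simp add: S_def)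
    then show ?thesis by blast
  qed
  have "S l \<subseteq> S k" if "k \<le> l" for k l
  proof -
    have "(?d + 1 / real (Suc l)) * t \<le> (?d + 1 / real (Suc k)) * t" if "0 \<le> t" for t
      using \<open>k \<le> l\<close> that by (intro mult_right_mono) (auto simp: field_simps)
    then show ?thesis unfolding S_def by (auto intro: order_trans)
  qed
  then have "\<Inter>(range S) \<noteq> {}" using compact nonempty by (intro compact_nest) auto
  then obtain A where A: "\<And>k. A \<in> S k" by blast
  then have A1: "nrm F (A *v x) \<le> nrm E x" for x by (auto simp: S_def)
  have d: "?d \<ge> 1" by (rule banach_mazur_ge_1)
  have A2: "nrm E x \<le> ?d * nrm F (A *v x)" for x
  proof -
    have "(\<lambda>k. 1 / real (Suc k)) \<longlonglongrightarrow> 0" using LIMSEQ_Suc[OF lim_1_over_n] .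
    then have "(\<lambda>k. (?d + 1 / real (Suc k)) * nrm F (A *v x)) \<longlonglongrightarrow> (?d + 0) * nrm F (A *v x)"
      by (intro tendsto_intros)
    then have "nrm E x \<le> (?d + 0) * nrm F (A *v x)"
      by (rule LIMSEQ_le_const) (use A in \<open>auto simp: S_def\<close>)
    then show ?thesis by simp
  qed
  \<comment> \<open>Scaling by \<open>?d\<close> turns \<open>A1\<close> and \<open>A2\<close> into
    the required bounds, with \<open>nrm E\<close> itself as the lower one.\<close>
  define T where "T x = ?d *\<^sub>R (A *v x)" for x
  have linT: "linear T" unfolding T_def by (intro linear_compose_scale_right matrix_vector_mul_linear)
  have nrmT: "nrm F (T x) = ?d * nrm F (A *v x)" for x using d by (simp add: T_def nrm_scaleR)
  have "x = 0" if "T x = 0" for x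
    using nrmT[of x] A2[of x] that nrm_nonneg[of E x] by (metis nrm_eq_0 nrm_zero order_antisym)
  then have "inj T" using linear_injective_0[OF linT] by blast
  then have bijT: "bij T" using linT by (simp add: bij_def linear_injective_imp_surjective)
  have "is_norm (\<lambda>x. nrm F (T x))"
    using \<open>\<And>x. T x = 0 \<Longrightarrow> x = 0\<close> unfolding is_norm_def
    by (auto simp: linear_add[OF linT] linear_scale[OF linT] linear_0[OF linT] nrm_scaleR nrm_triangle)
  then have G: "nrm (normed_space_of (\<lambda>x. nrm F (T x))) = (\<lambda>x. nrm F (T x))"
    by (rule nrm_normed_space_of)
  show ?thesis
  proof (rule that)
    show "isometric (normed_space_of (\<lambda>x. nrm F (T x))) F"
      unfolding isometric_def G using linT bijT by blast
    fix x
    show "nrm E x \<le> nrm (normed_space_of (\<lambda>x. nrm F (T x))) x"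
      unfolding G unfolding nrmT by (rule A2)
    show "nrm (normed_space_of (\<lambda>x. nrm F (T x))) x \<le> ?d * nrm E x"
      unfolding G unfolding nrmT using A1 d by (intro mult_left_mono) auto
  qed
qed

text \<open>A lower bound \<open>\<mu>\<close> and an upper bound \<open>\<nu>\<close> for \<open>nrm F / nrm E\<close> satisfy
  \<open>banach_mazur E F \<le> \<nu> / \<mu>\<close>, so both inequalities of an optimal position are attained.\<close>

lemma contact_points:
  fixes E F :: "'n::finite normed_space"
  assumes "\<And>x. nrm E x \<le> nrm F x" "\<And>x. nrm F x \<le> banach_mazur E F * nrm E x"
  obtains x y where "x \<noteq> 0" "nrm F x = nrm E x" "y \<noteq> 0" "nrm F y = banach_mazur E F * nrm E y"
proof -
  let ?d = "banach_mazur E F" and ?r = "\<lambda>x. nrm F x / nrm E x"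
  let ?S = "sphere (0 :: real ^ 'n) 1"
  have S: "compact ?S" "?S \<noteq> {}" by auto
  have pos: "0 < nrm E x" if "x \<in> ?S" for x using that by (intro nrm_pos) auto
  have "\<forall>x\<in>?S. nrm E x \<noteq> 0" using pos by fastforce
  then have cont: "continuous_on ?S ?r" by (intro continuous_on_divide continuous_nrm)
  obtain x where x: "x \<in> ?S" "\<And>z. z \<in> ?S \<Longrightarrow> ?r x \<le> ?r z"
    using continuous_attains_inf[OF S cont] by blast
  obtain y where y: "y \<in> ?S" "\<And>z. z \<in> ?S \<Longrightarrow> ?r z \<le> ?r y"
    using continuous_attains_sup[OF S cont] by blast
  \<comment> \<open>The ratio \<open>?r\<close> is homogeneous of degree 0, so its extrema on the
    sphere bound it everywhere off 0.\<close>
  have r: "?r x * nrm E z \<le> nrm F z \<and> nrm F z \<le> ?r y * nrm E z" for z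
  proof (cases "z = 0")
    case False
    let ?w = "(1 / norm z) *\<^sub>R z"
    have "?w \<in> ?S" using False by simp
    moreover have "?r ?w = ?r z" using False by (simp add: nrm_scaleR)
    ultimately have "?r x \<le> ?r z" "?r z \<le> ?r y" using x(2) y(2) by metis+
    then show ?thesis using nrm_pos[OF False, of E] by (simp add: field_simps)
  qed simp
  define \<mu> \<nu> where "\<mu> = ?r x" and "\<nu> = ?r y"
  have \<mu>: "1 \<le> \<mu>" using assms(1)[of x] pos[OF x(1)] by (simp add: \<mu>_def)
  have \<nu>: "\<nu> \<le> ?d" using assms(2)[of y] pos[OF y(1)] by (simp add: \<nu>_def divide_le_eq)
  have "1 \<le> \<nu>" using \<mu> x(2)[OF y(1)] by (simp add: \<mu>_def \<nu>_def)
  have "?d \<le> \<nu> * (1 / \<mu>)"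
  proof (rule banach_mazur_le_bounds)
    fix z
    show "nrm F z \<le> \<nu> * nrm E z" using r by (simp add: \<nu>_def)
    have "\<mu> * nrm E z \<le> nrm F z" using r by (simp add: \<mu>_def)
    then show "nrm E z \<le> 1 / \<mu> * nrm F z" using \<mu> by (simp add: field_simps)
  qed (use \<mu> \<open>1 \<le> \<nu>\<close> in auto)
  \<comment> \<open>Together with \<open>1 \<le> \<mu>\<close> and \<open>\<nu> \<le> ?d\<close>
    this forces equality in both.\<close>
  then have *: "?d * \<mu> \<le> \<nu>" using \<mu> by (simp add: field_simps)
  have d: "1 \<le> ?d" by (rule banach_mazur_ge_1)
  have "?d * 1 \<le> ?d * \<mu>" using d \<mu> by (intro mult_left_mono) auto
  then have "\<nu> = ?d" "?d * \<mu> = ?d * 1" using * \<nu> by linarith+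
  then have "\<mu> = 1" using d by simp
  then have "nrm F x = nrm E x" "nrm F y = ?d * nrm E y"
    using \<open>\<nu> = ?d\<close> pos[OF x(1)] pos[OF y(1)] by (auto simp: \<mu>_def \<nu>_def divide_eq_eq split: if_splits)
  moreover have "x \<noteq> 0" "y \<noteq> 0" using x(1) y(1) by auto
  ultimately show ?thesis using that by blast
qed

section \<open>Uncountably many isometry classes between two norms\<close>

text \<open>Intermediate value theorem on the punctured space, which is connected from dimension 2
  on.\<close>

lemma norm_ratio_intermediate:
  fixes P Q :: "'n::finite normed_space"
  assumes "2 \<le> CARD('n)" "x \<noteq> 0" "nrm P x \<le> c * nrm Q x" "y \<noteq> 0" "c * nrm Q y \<le> nrm P y"
  obtains z where "z \<noteq> 0" "nrm P z = c * nrm Q z"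
proof -
  let ?f = "\<lambda>z. nrm P z - c * nrm Q z"
  have "connected (- {0 :: real ^ 'n})"
    using assms(1) by (intro connected_punctured_universe) simp
  moreover have "continuous_on (- {0}) ?f" by (intro continuous_intros continuous_nrm)
  ultimately have "connected (?f ` (- {0}))" by (rule connected_continuous_image[rotated])
  then have "0 \<in> ?f ` (- {0})"
    by (rule connectedD_interval[of _ "?f x" "?f y"]) (use assms in auto)
  then obtain z where "z \<in> - {0}" "0 = ?f z" by blast
  then show ?thesis using that[of z] by simp
qed

text \<open>The target has dimension \<open>n\<^sup>2 + 1\<close>, one more than the space of matrices.\<close>

lemma negligible_isometric_values:
  fixes L :: "'n::finite normed_space" and p :: "('n \<times> 'n) option \<Rightarrow> real ^ 'n"
  shows "negligible (range (\<lambda>A :: real ^ 'n ^ 'n. \<chi> j. nrm L (A *v p j) / a j - b j))"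
proof -
  let ?f = "\<lambda>A :: real ^ 'n ^ 'n. (\<chi> j. nrm L (A *v p j) / a j - b j)"
  \<comment> \<open>The matrices are embedded as this null hyperplane in a space of the same
    dimension as the target, so that a Lipschitz image of it is again null.\<close>
  let ?U = "{z :: (real ^ 'n ^ 'n) \<times> real. (0, 1) \<bullet> z = 0}"
  obtain C where C: "C > 0" "\<And>x. nrm L x \<le> C * norm x" using nrm_upper by blast
  have "\<exists>B. \<forall>A A'. \<bar>(?f A - ?f A') $ j\<bar> \<le> B * norm (A - A')" for j
  proof -
    have "bounded_linear (\<lambda>A :: real ^ 'n ^ 'n. A *v p j)"
      unfolding linear_conv_bounded_linear[symmetric]
      by (intro linearI) (auto simp: matrix_vector_mult_add_rdistrib scaleR_matrix_vector_assoc)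
    then obtain B where B: "\<And>A :: real ^ 'n ^ 'n. norm (A *v p j) \<le> norm A * B"
      using bounded_linear.bounded by blast
    \<comment> \<open>If \<open>a j = 0\<close>, both sides are 0, since division by 0 yields
      0.\<close>
    have "\<bar>(?f A - ?f A') $ j\<bar> \<le> (C * B / \<bar>a j\<bar>) * norm (A - A')" for A A'
    proof -
      have "\<bar>nrm L (A *v p j) - nrm L (A' *v p j)\<bar> \<le> nrm L ((A - A') *v p j)"
        using nrm_diff by (simp add: matrix_vector_mult_diff_rdistrib)
      also have "\<dots> \<le> C * norm ((A - A') *v p j)" by (rule C(2))
      also have "\<dots> \<le> C * (norm (A - A') * B)" using B C(1) by (intro mult_left_mono) auto
      finally have "\<bar>nrm L (A *v p j) - nrm L (A' *v p j)\<bar> / \<bar>a j\<bar> \<le> C * (norm (A - A') * B) / \<bar>a j\<bar>"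
        by (rule divide_right_mono) simp
      then show ?thesis by (simp add: abs_divide[symmetric] diff_divide_distrib mult_ac)
    qed
    then show ?thesis by blast
  qed
  then have "\<exists>B. \<forall>j A A'. \<bar>(?f A - ?f A') $ j\<bar> \<le> B j * norm (A - A')" by (intro choice allI)
  then obtain B where B: "\<And>j A A'. \<bar>(?f A - ?f A') $ j\<bar> \<le> B j * norm (A - A')" by blast
  have lip: "norm (?f A - ?f A') \<le> sum B UNIV * norm (A - A')" for A A'
  proof -
    have "norm (?f A - ?f A') \<le> (\<Sum>j\<in>UNIV. \<bar>(?f A - ?f A') $ j\<bar>)" by (rule norm_le_l1_cart)
    also have "\<dots> \<le> (\<Sum>j\<in>UNIV. B j * norm (A - A'))" by (intro sum_mono B)
    finally show ?thesis by (simp add: sum_distrib_right)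
  qed
  have "negligible ((\<lambda>z. ?f (fst z)) ` ?U)"
  proof (rule negligible_locally_Lipschitz_image)
    show "DIM((real ^ 'n ^ 'n) \<times> real) \<le> DIM(real ^ (('n \<times> 'n) option))"
      by (simp add: card_UNIV_option)
    show "negligible ?U" by (rule negligible_hyperplane) (auto simp: zero_prod_def)
    show "\<exists>T B. open T \<and> z \<in> T \<and>
        (\<forall>w \<in> ?U \<inter> T. norm (?f (fst w) - ?f (fst z)) \<le> B * norm (w - z))"
      if "z \<in> ?U" for z
    proof (intro exI[of _ UNIV] exI conjI ballI)
      fix w :: "(real ^ 'n ^ 'n) \<times> real"
      have "norm (?f (fst w) - ?f (fst z)) \<le> sum B UNIV * norm (fst w - fst z)" by (rule lip)
      also have "\<dots> \<le> \<bar>sum B UNIV\<bar> * norm (w - z)"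
        using norm_fst_le[of "fst (w - z)" "snd (w - z)", unfolded prod.collapse]
        by (intro mult_mono) auto
      finally show "norm (?f (fst w) - ?f (fst z)) \<le> \<bar>sum B UNIV\<bar> * norm (w - z)" .
    qed auto
  qed
  moreover have "?f A \<in> (\<lambda>z. ?f (fst z)) ` ?U" for A
    by (rule image_eqI[of _ _ "(A, 0)"]) auto
  then have "range ?f \<subseteq> (\<lambda>z. ?f (fst z)) ` ?U" by (rule image_subsetI)
  ultimately show ?thesis by (rule negligible_subset)
qed

text \<open>Suppose that a countable set \<open>S\<close> represents all classes. A norm
  \<open>K\<close> of the cube, with parameter \<open>s\<close>, is isometric to some
  \<open>L\<close> in \<open>S\<close> through a matrix, and \<open>s\<close> is a function of the
  values of \<open>L\<close> at the images of the points \<open>p j\<close>. By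
  \<open>negligible_isometric_values\<close> each \<open>L\<close> accounts only for a null set of
  parameters.\<close>

lemma uncountable_norm_interval:
  fixes P Q :: "'n::finite normed_space"
  assumes card: "2 \<le> CARD('n)" and le: "\<And>x. nrm P x \<le> nrm Q x"
    and x0: "x0 \<noteq> 0" "nrm P x0 = nrm Q x0" and y0: "nrm P y0 < nrm Q y0"
  shows "uncountable (isometry_class ` {K. \<forall>x. nrm P x \<le> nrm K x \<and> nrm K x \<le> nrm Q x})"
    (is "uncountable (isometry_class ` ?I)")
proof
  assume "countable (isometry_class ` ?I)"
  then obtain S where S: "countable S" "isometry_class ` ?I = isometry_class ` S"
    by (auto simp: countable_image_eq)
  \<comment> \<open>The ratio of \<open>P\<close> to \<open>Q\<close> is \<open>m\<close> at
    \<open>y0\<close> and 1 at \<open>x0\<close>, so every value in between is attained; a distinct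
    one is picked for each of the n^2 + 1 indices.\<close>
  define m where "m = nrm P y0 / nrm Q y0"
  have "y0 \<noteq> 0" using y0 by auto
  then have m: "0 < m" "m < 1" "nrm P y0 = m * nrm Q y0"
    using y0 nrm_pos[of y0] by (auto simp: m_def)
  have "infinite {m<..<1}" using m by simp
  then obtain R where R: "finite R" "card R = CARD(('n \<times> 'n) option)" "R \<subseteq> {m<..<1}"
    using infinite_arbitrarily_large by blast
  then obtain r :: "('n \<times> 'n) option \<Rightarrow> real" where r: "bij_betw r UNIV R"
    using finite_same_card_bij[OF finite_class.finite_UNIV R(1)] by metis
  have r1: "m < r i" "r i < 1" for i
    using bij_betwE[OF r] R(3) by (force dest: subsetD)+
  have r0: "0 < r i" for i using m(1) r1(1) by (rule less_trans)
  have "\<exists>z. z \<noteq> 0 \<and> nrm P z = r i * nrm Q z" for i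
  proof (rule norm_ratio_intermediate[OF card])
    show "nrm P y0 \<le> r i * nrm Q y0" using m(3) r1(1)[of i] by (simp add: mult_right_mono)
    show "r i * nrm Q x0 \<le> nrm P x0"
      using x0(2) r1(2)[of i] mult_right_mono[of "r i" 1 "nrm Q x0"] by simp
  qed (use x0 \<open>y0 \<noteq> 0\<close> in auto)
  then obtain p where p: "\<And>i. p i \<noteq> 0" "\<And>i. nrm P (p i) = r i * nrm Q (p i)" by metis
  \<comment> \<open>Intercept of the tangent of the parabola \<open>(1 + t\<^sup>2) / 2\<close> at
    \<open>r i\<close>; the tangent lies below the parabola by exactly
    \<open>(t - r i)\<^sup>2 / 2\<close>.\<close>
  define a where "a i = (1 - (r i)\<^sup>2) / 2" for i
  have small: "\<forall>\<^sub>F \<delta> in at_right 0. \<delta> < t" if "0 < t" for t :: real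
    using eventually_at_right_real[OF that] by eventually_elim auto
  have "\<forall>\<^sub>F \<delta> in at_right (0::real). \<delta> < (1 - r i)\<^sup>2 / 2" for i
    using r1(2)[of i] by (intro small) simp
  moreover have "\<forall>\<^sub>F \<delta> in at_right (0::real). i = j \<or> \<delta> < (r i - r j)\<^sup>2 / 2" for i j
  proof (cases "i = j")
    case False
    then have "r i \<noteq> r j" using r by (auto simp: bij_betw_def dest: injD)
    then show ?thesis using False small[of "(r i - r j)\<^sup>2 / 2"] by simp
  qed simp
  \<comment> \<open>Raised by at most \<open>\<delta>\<close>, the tangent at \<open>r i\<close>
    stays below the parabola at 1, where the value is 1, and at every other \<open>r j\<close>. The
    first gives \<open>N i \<le> Q\<close>, the second keeps the parameters independent.\<close>
  ultimately have ev: "\<forall>\<^sub>F \<delta> in at_right (0::real). 0 < \<delta> \<and> (\<forall>i. \<delta> < (1 - r i)\<^sup>2 / 2) \<and>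
      (\<forall>i j. i = j \<or> \<delta> < (r i - r j)\<^sup>2 / 2)"
    by (intro eventually_conj eventually_all_finite eventually_at_right_less)
  obtain \<delta> where \<delta>: "0 < \<delta>" "\<And>i. \<delta> < (1 - r i)\<^sup>2 / 2"
      "\<And>i j. i = j \<or> \<delta> < (r i - r j)\<^sup>2 / 2"
    using eventually_happens'[OF trivial_limit_at_right_real ev] by blast
  let ?cube = "cbox 0 (\<chi> i. \<delta>) :: (real ^ ('n \<times> 'n) option) set"
  \<comment> \<open>Recovers the parameter: at \<open>p j\<close> the ratio of \<open>K\<close> to
    \<open>Q\<close> is the value of the parabola at \<open>r j\<close> plus
    \<open>s $ j\<close>.\<close>
  let ?f = "\<lambda>L A. \<chi> i. nrm L (A *v p i) / nrm Q (p i) - (1 + (r i)\<^sup>2) / 2"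
  have "?cube \<subseteq> (\<Union>L\<in>S. range (?f L))"
  proof
    fix s assume "s \<in> ?cube"
    then have s: "0 \<le> s $ i" "s $ i \<le> \<delta>" for i by (auto simp: mem_box_cart)
    txt \<open>\<open>N i\<close> is \<open>Q\<close> times \<open>h (P / Q)\<close>, where \<open>h\<close> is the tangent of \<open>t \<mapsto> (1 + t\<^sup>2) / 2\<close> at \<open>r i\<close> raised by
      \<open>s $ i\<close>; so \<open>N j\<close> dominates all other \<open>N i\<close> at \<open>p j\<close>.\<close>
    define N where "N i x = r i * nrm P x + (a i + s $ i) * nrm Q x" for i x
    \<comment> \<open>The maximum with \<open>P\<close> secures the lower bound; it leaves the
      values at \<open>p j\<close> unchanged because
      \<open>r j \<le> (1 + (r j)\<^sup>2) / 2\<close>.\<close>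
    define K where "K x = max (nrm P x) (MAX i\<in>UNIV. N i x)" for x
    have a: "0 < a i + s $ i" for i
    proof -
      have "(r i)\<^sup>2 < 1" using r0[of i] r1(2)[of i] by (simp add: power_less_one_iff abs_square_less_1)
      then show ?thesis unfolding a_def using s(1)[of i] by (intro add_pos_nonneg) auto
    qed
    have "is_norm K" unfolding K_def N_def
      using a r0 by (intro is_norm_max is_norm_Max is_norm_lincomb is_norm_nrm) (auto intro: less_imp_le)
    then have K: "nrm (normed_space_of K) = K" by (rule nrm_normed_space_of)
    have "N i x \<le> nrm Q x" for i x
    proof -
      have "N i x \<le> r i * nrm Q x + (a i + s $ i) * nrm Q x"
        unfolding N_def using le r0[of i] by simp
      also have "\<dots> = (r i + a i + s $ i) * nrm Q x" by (simp add: algebra_simps)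
      also have "\<dots> \<le> 1 * nrm Q x"
      proof (rule mult_right_mono)
        have "s $ i \<le> (1 - r i)\<^sup>2 / 2" using s(2)[of i] \<delta>(2)[of i] by simp
        then show "r i + a i + s $ i \<le> 1" unfolding a_def by (simp add: power2_eq_square field_simps)
      qed simp
      finally show ?thesis by simp
    qed
    then have "normed_space_of K \<in> ?I" using le by (auto simp: K K_def)
    then have "isometry_class (normed_space_of K) \<in> isometry_class ` S"
      unfolding S(2)[symmetric] by (rule imageI)
    then obtain L where L: "L \<in> S" "isometry_class (normed_space_of K) = isometry_class L"
      by blast
    then have "isometric (normed_space_of K) L" by (simp add: BM.abs_eq_iff)
    then obtain T where T: "linear T" "\<forall>x. nrm L (T x) = K x"
      unfolding isometric_def K by blast
    have Kp: "K (p j) = ((1 + (r j)\<^sup>2) / 2 + s $ j) * nrm Q (p j)" (is "_ = ?c j * _") for j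
    proof -
      have Np: "N i (p j) = (r i * r j + a i + s $ i) * nrm Q (p j)" for i
        by (simp add: N_def p(2) algebra_simps)
      have "r i * r j + a i + s $ i \<le> ?c j" for i
        using \<delta>(3)[of i j] s(2)[of i] s(1)[of j]
        by (auto simp: a_def power2_eq_square field_simps)
      then have "N i (p j) \<le> ?c j * nrm Q (p j)" for i
        unfolding Np by (rule mult_right_mono) simp
      moreover have "N j (p j) = ?c j * nrm Q (p j)"
        unfolding Np by (simp add: a_def power2_eq_square field_simps)
      ultimately have "(MAX i\<in>UNIV. N i (p j)) = ?c j * nrm Q (p j)"
        by (intro Max_eqI) (auto intro!: image_eqI[of _ _ j])
      moreover have "r j \<le> ?c j"
        using s(1)[of j] zero_le_power2[of "1 - r j"] by (simp add: power2_eq_square field_simps)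
      then have "nrm P (p j) \<le> ?c j * nrm Q (p j)"
        unfolding p(2) by (rule mult_right_mono) simp
      ultimately show ?thesis by (simp add: K_def)
    qed
    have "s = ?f L (matrix T)"
      using p(1) by (simp add: vec_eq_iff T(2) Kp matrix_works[OF T(1)[folded linear_matrix_vector_mul_eq]])
    then show "s \<in> (\<Union>L\<in>S. range (?f L))" using L(1) by blast
  qed
  moreover have "negligible (\<Union>L\<in>S. range (?f L))"
    using S(1) negligible_isometric_values by (intro negligible_countable_Union) auto
  ultimately have "negligible ?cube" by (rule negligible_subset[rotated])
  then show False using \<delta>(1) by (auto simp: negligible_interval interval_eq_empty_cart)
qed

section \<open>Geodesics in metric spaces\<close>

text \<open>The sum over any partition is at most a telescoping sum with value \<open>b - a\<close>,
  and the partition into a single interval attains it.\<close>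

lemma path_length_eqI:
  assumes "a \<le> b" "dist (\<gamma> a) (\<gamma> b) = b - a"
    and "\<And>s t. a \<le> s \<Longrightarrow> s \<le> t \<Longrightarrow> t \<le> b \<Longrightarrow> dist (\<gamma> s) (\<gamma> t) \<le> t - s"
  shows "path_length \<gamma> a b = ereal (b - a)"
proof (rule antisym)
  show "path_length \<gamma> a b \<le> ereal (b - a)"
    unfolding path_length_def
  proof (rule SUP_least, clarify)
    fix m and t :: "nat \<Rightarrow> real"
    assume t: "\<forall>i<m. t i \<le> t (Suc i)" "a = t 0" "b = t m"
    have mono: "t i \<le> t j" if "i \<le> j" "j \<le> m" for i j
      using that by (induction j rule: dec_induct) (use t(1) in \<open>auto intro: order_trans\<close>)
    have "(\<Sum>i=1..m. dist (\<gamma> (t i)) (\<gamma> (t (i - 1)))) \<le> (\<Sum>i=1..m. t i - t (i - 1))"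
    proof (rule sum_mono)
      fix i assume "i \<in> {1..m}"
      then show "dist (\<gamma> (t i)) (\<gamma> (t (i - 1))) \<le> t i - t (i - 1)"
        unfolding dist_commute[of "\<gamma> (t i)"] by (intro assms(3)) (auto simp: t(2,3) intro: mono)
    qed
    also have "\<dots> = t m - t 0"
      using sum_telescope''[of 0 m t] by (simp add: atLeastSucAtMost_greaterThanAtMost)
    finally show "ereal (\<Sum>i=1..m. dist (\<gamma> (t i)) (\<gamma> (t (i - 1)))) \<le> ereal (t m - t 0)" by simp
  qed
  have "ereal (\<Sum>i=1..(1::nat). dist (\<gamma> ((\<lambda>i. if i = 0 then a else b) i)) (\<gamma> ((\<lambda>i. if i = 0 then a else b) (i - 1))))
      \<le> path_length \<gamma> a b"
    unfolding path_length_def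
    by (rule SUP_upper2[of "(1, \<lambda>i. if i = 0 then a else b)"]) (use assms(1) in auto)
  then show "ereal (b - a) \<le> path_length \<gamma> a b" using assms(2) by (simp add: dist_commute)
qed

lemma geodesicI:
  assumes "0 \<le> D" "\<gamma> 0 = x" "\<gamma> D = y" "dist x y = D"
    and lip: "\<And>s t. 0 \<le> s \<Longrightarrow> s \<le> t \<Longrightarrow> t \<le> D \<Longrightarrow> dist (\<gamma> s) (\<gamma> t) \<le> t - s"
  shows "geodesic \<gamma> 0 D x y"
proof -
  have "1-lipschitz_on {0..D} \<gamma>"
  proof (rule lipschitz_onI)
    fix s t assume "s \<in> {0..D}" "t \<in> {0..D}"
    then show "dist (\<gamma> s) (\<gamma> t) \<le> 1 * dist s t"
      using lip[of s t] lip[of t s] by (cases "s \<le> t") (auto simp: dist_real_def dist_commute)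
  qed simp
  then have "continuous_on {0..D} \<gamma>" by (rule lipschitz_on_continuous_on)
  moreover have "path_length \<gamma> 0 D = ereal (D - 0)"
    using assms by (intro path_length_eqI) auto
  ultimately show ?thesis using assms by (simp add: geodesic_def)
qed

text \<open>The sum over the partition \<open>a, s, t, b\<close> is at most the length, which for a
  geodesic is \<open>dist x y\<close>.\<close>

lemma geodesic_dist_add:
  assumes "geodesic \<gamma> a b x y" "a \<le> s" "s \<le> t" "t \<le> b"
  shows "dist x (\<gamma> s) + dist (\<gamma> s) (\<gamma> t) + dist (\<gamma> t) y \<le> dist x y"
proof -
  let ?t = "\<lambda>i::nat. if i = 0 then a else if i = 1 then s else if i = 2 then t else b"
  have "ereal (\<Sum>i=1..3. dist (\<gamma> (?t i)) (\<gamma> (?t (i - 1)))) \<le> path_length \<gamma> a b"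
    unfolding path_length_def
    by (rule SUP_upper2[of "(3, ?t)"]) (use assms in \<open>auto simp: less_Suc_eq numeral_3_eq_3\<close>)
  moreover have "{1..3::nat} = {1, 2, 3}" by auto
  ultimately show ?thesis using assms(1) by (simp add: geodesic_def dist_commute)
qed

text \<open>Whichever point comes first on the path, \<open>geodesic_dist_add\<close> and the
  triangle inequality leave no room for a positive distance between two points equally far from
  \<open>x\<close>.\<close>

lemma geodesic_trace_dist_unique:
  assumes "\<tau> \<in> geodesic_traces x y" "p \<in> \<tau>" "q \<in> \<tau>" "dist x p = dist x q"
  shows "p = q"
proof -
  obtain \<gamma> a b s t where \<gamma>: "geodesic \<gamma> a b x y" "s \<in> {a..b}" "t \<in> {a..b}" "p = \<gamma> s" "q = \<gamma> t"
    using assms(1-3) unfolding geodesic_traces_def by blast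
  have "dist (\<gamma> s) (\<gamma> t) \<le> 0"
  proof (cases "s \<le> t")
    case True
    then have "dist x (\<gamma> s) + dist (\<gamma> s) (\<gamma> t) + dist (\<gamma> t) y \<le> dist x y"
      using \<gamma>(2,3) by (intro geodesic_dist_add[OF \<gamma>(1)]) auto
    then show ?thesis using assms(4)[unfolded \<gamma>(4,5)] dist_triangle[of x y "\<gamma> t"] by linarith
  next
    case False
    then have "dist x (\<gamma> t) + dist (\<gamma> t) (\<gamma> s) + dist (\<gamma> s) y \<le> dist x y"
      using \<gamma>(2,3) by (intro geodesic_dist_add[OF \<gamma>(1)]) auto
    then show ?thesis
      using assms(4)[unfolded \<gamma>(4,5)] dist_triangle[of x y "\<gamma> s"]
      unfolding dist_commute[of "\<gamma> s" "\<gamma> t"] by linarith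
  qed
  then show ?thesis using \<gamma> by simp
qed

text \<open>Choosing a trace through each point of \<open>S\<close> is injective, since a trace has
  at most one point at distance \<open>r\<close> from \<open>x\<close>.\<close>

lemma uncountable_geodesic_traces:
  assumes "uncountable S" "\<And>p. p \<in> S \<Longrightarrow> dist x p = r"
    and "\<And>p. p \<in> S \<Longrightarrow> \<exists>\<tau>\<in>geodesic_traces x y. p \<in> \<tau>"
  shows "uncountable (geodesic_traces x y)"
proof
  assume "countable (geodesic_traces x y)"
  obtain \<tau> where \<tau>: "\<And>p. p \<in> S \<Longrightarrow> \<tau> p \<in> geodesic_traces x y \<and> p \<in> \<tau> p"
    using assms(3) by metis
  have "inj_on \<tau> S"
  proof (rule inj_onI)
    fix p q assume "p \<in> S" "q \<in> S" "\<tau> p = \<tau> q"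
    then show "p = q"
      using \<tau>[of p] \<tau>[of q] assms(2) by (intro geodesic_trace_dist_unique[of "\<tau> p"]) auto
  qed
  moreover have "\<tau> ` S \<subseteq> geodesic_traces x y" using \<tau> by blast
  ultimately show False
    using assms(1) \<open>countable (geodesic_traces x y)\<close> countable_image_inj_on countable_subset by blast
qed

section \<open>The geodesic through a given midpoint\<close>

text \<open>The path is at \<open>E\<close> at time 0, at \<open>K\<close> at time
  \<open>ln \<kappa>\<close> and at \<open>M\<close> at time \<open>ln (\<kappa>\<^sup>2)\<close>.
  The cap \<open>min (exp t) \<kappa>\<close> stops the multiple of \<open>K\<close> at 1; without
  it the path would end at \<open>\<kappa>\<close> times \<open>K\<close>, which dominates
  \<open>M\<close>.\<close>

lemma geodesic_through:
  fixes E K M :: "'n::finite normed_space"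
  assumes d: "banach_mazur E M = \<kappa>\<^sup>2" "1 \<le> \<kappa>"
    and EM: "\<And>x. nrm E x \<le> nrm M x" "\<And>x. nrm M x \<le> \<kappa>\<^sup>2 * nrm E x"
    and EK: "\<And>x. nrm E x \<le> nrm K x" "\<And>x. nrm K x \<le> \<kappa> * nrm E x"
    and KM: "\<And>x. nrm K x \<le> nrm M x" "\<And>x. nrm M x \<le> \<kappa> * nrm K x"
  shows "\<exists>\<tau>\<in>geodesic_traces (isometry_class E) (isometry_class M). isometry_class K \<in> \<tau>"
proof -
  let ?D = "ln (\<kappa>\<^sup>2)"
  txt \<open>\<open>N t\<close> increases and \<open>exp (- t) * N t\<close> decreases in \<open>t\<close>, which makes the path 1-Lipschitz.\<close>
  define N where "N t x = max (nrm E x) (max (min (exp t) \<kappa> / \<kappa> * nrm K x) (exp t / \<kappa>\<^sup>2 * nrm M x))"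
    for t x
  define \<gamma> where "\<gamma> t = isometry_class (normed_space_of (N t))" for t
  have \<kappa>: "0 < \<kappa>" using d(2) by simp
  have "is_norm (N t)" for t unfolding N_def
    using \<kappa> by (intro is_norm_max is_norm_scale is_norm_nrm) auto
  then have N: "nrm (normed_space_of (N t)) = N t" for t by (rule nrm_normed_space_of)
  have N_eq: "\<gamma> t = isometry_class G" if "\<And>x. N t x = nrm G x" for t G
  proof -
    have "N t = nrm G" using that by blast
    then show ?thesis by (simp add: \<gamma>_def nrm_inverse)
  qed
  have exp_D: "exp ?D = \<kappa>\<^sup>2" "exp (ln \<kappa>) = \<kappa>" using \<kappa> by auto
  have \<kappa>2: "\<kappa> \<le> \<kappa>\<^sup>2" using d(2) by (simp add: power2_eq_square)
  have "\<gamma> 0 = isometry_class E"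
  proof (rule N_eq)
    fix x
    have "nrm K x / \<kappa> \<le> nrm E x" "nrm M x / \<kappa>\<^sup>2 \<le> nrm E x"
      using EM(2)[of x] EK(2)[of x] \<kappa> by (simp_all add: field_simps)
    moreover have "N 0 x = max (nrm E x) (max (nrm K x / \<kappa>) (nrm M x / \<kappa>\<^sup>2))"
      unfolding N_def using d(2) by simp
    ultimately show "N 0 x = nrm E x" by simp
  qed
  moreover have "\<gamma> ?D = isometry_class M"
  proof (rule N_eq)
    fix x
    have "N ?D x = max (nrm E x) (max (nrm K x) (nrm M x))"
      unfolding N_def exp_D using \<kappa> \<kappa>2 by (simp add: min_def)
    then show "N ?D x = nrm M x" using EM(1) KM(1) by (simp add: max_def)
  qed
  moreover have \<gamma>K: "\<gamma> (ln \<kappa>) = isometry_class K"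
  proof (rule N_eq)
    fix x
    have "nrm M x / \<kappa> \<le> nrm K x" using KM(2)[of x] \<kappa> by (simp add: field_simps)
    then have "\<kappa> / \<kappa>\<^sup>2 * nrm M x \<le> nrm K x" using \<kappa> by (simp add: power2_eq_square)
    moreover have "N (ln \<kappa>) x = max (nrm E x) (max (nrm K x) (\<kappa> / \<kappa>\<^sup>2 * nrm M x))"
      unfolding N_def exp_D using \<kappa> by simp
    ultimately show "N (ln \<kappa>) x = nrm K x" using EK(1) by (simp add: max_def)
  qed
  moreover have "dist (\<gamma> s) (\<gamma> t) \<le> t - s" if "s \<le> t" for s t
  proof -
    have st: "exp s \<le> exp t" "1 \<le> exp (t - s)" "exp t = exp (t - s) * exp s"
      using that by (auto simp: exp_diff)
    have "N s x \<le> N t x" for x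
      unfolding N_def using st \<kappa>
      by (intro max.mono mult_right_mono divide_right_mono min.mono) auto
    moreover have "N t x \<le> exp (t - s) * N s x" for x
    proof -
      have "nrm E x \<le> exp (t - s) * nrm E x"
        using st(2) mult_right_mono[of 1 "exp (t - s)" "nrm E x"] by simp
      moreover have "min (exp t) \<kappa> / \<kappa> * nrm K x \<le> exp (t - s) * (min (exp s) \<kappa> / \<kappa> * nrm K x)"
      proof -
        have "min (exp t) \<kappa> \<le> exp (t - s) * min (exp s) \<kappa>"
          using st(1,3) mult_right_mono[OF st(2), of \<kappa>] \<kappa> unfolding min_def by (smt (verit))
        then have "min (exp t) \<kappa> / \<kappa> * nrm K x \<le> exp (t - s) * min (exp s) \<kappa> / \<kappa> * nrm K x"
          using \<kappa> by (intro mult_right_mono divide_right_mono) auto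
        then show ?thesis by simp
      qed
      moreover have "exp t / \<kappa>\<^sup>2 * nrm M x = exp (t - s) * (exp s / \<kappa>\<^sup>2 * nrm M x)"
        using st(3) by simp
      ultimately show ?thesis
        unfolding N_def max_mult_distrib_left by (auto simp: max_def)
    qed
    ultimately have "banach_mazur (normed_space_of (N s)) (normed_space_of (N t)) \<le> exp (t - s) * 1"
      by (intro banach_mazur_le_bounds) (simp_all add: N)
    then have "ln (banach_mazur (normed_space_of (N s)) (normed_space_of (N t))) \<le> ln (exp (t - s))"
      using banach_mazur_ge_1[of "normed_space_of (N s)" "normed_space_of (N t)"]
      by (subst ln_le_cancel_iff) auto
    then show ?thesis by (simp add: \<gamma>_def dist_isometry_class)
  qed
  ultimately have "geodesic \<gamma> 0 ?D (isometry_class E) (isometry_class M)"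
    using d by (intro geodesicI) (auto simp: dist_isometry_class)
  moreover have "ln \<kappa> \<in> {0..?D}" using d(2) \<kappa>2 by simp
  ultimately show ?thesis unfolding geodesic_traces_def using \<gamma>K by (metis (mono_tags, lifting) CollectI imageI)
qed

section \<open>The interval of midpoints between two spaces\<close>

theorem corollary3:
  fixes E F :: "'n::finite normed_space"
  assumes "CARD('n) \<ge> 3"
    and "\<not> isometric E F"
  shows "uncountable (geodesic_traces (isometry_class E) (isometry_class F))"
proof -
  obtain M where M: "isometric M F" "\<And>x. nrm E x \<le> nrm M x"
      "\<And>x. nrm M x \<le> banach_mazur E F * nrm E x"
    by (rule optimal_position[where E = E and F = F]) (rule that)
  have class_M: "isometry_class M = isometry_class F" using M(1) by (simp add: BM.abs_eq_iff)
  have "banach_mazur M F = 1" "banach_mazur F M = 1"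
    using M(1) banach_mazur_commute[of F M] by (simp_all add: banach_mazur_eq_1_iff[symmetric])
  then have d_eq: "banach_mazur E M = banach_mazur E F"
    using banach_mazur_triangle[of E M F] banach_mazur_triangle[of E F M] by simp
  define \<kappa> where "\<kappa> = sqrt (banach_mazur E F)"
  have "1 < banach_mazur E F"
    using assms(2) banach_mazur_ge_1[of E F] by (simp add: banach_mazur_eq_1_iff[symmetric])
  then have d: "banach_mazur E F = \<kappa>\<^sup>2" and \<kappa>: "1 < \<kappa>" by (auto simp: \<kappa>_def)
  have EM: "nrm E x \<le> nrm M x" "nrm M x \<le> \<kappa>\<^sup>2 * nrm E x" for x
    using M(2,3) by (auto simp: d)
  obtain x y where x: "x \<noteq> 0" "nrm M x = nrm E x" and y: "y \<noteq> 0" "nrm M y = \<kappa>\<^sup>2 * nrm E y"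
    using contact_points[where E = E and F = M] EM unfolding d_eq d by metis
  have "2 \<le> CARD('n)" using assms(1) by simp
  \<comment> \<open>At \<open>z\<close> the ratio of \<open>M\<close> to \<open>E\<close> is the
    geometric mean of its extremes 1 and \<open>\<kappa>\<^sup>2\<close>. There \<open>P\<close> is
    strictly below \<open>Q\<close>, whereas they agree at \<open>x\<close>.\<close>
  then obtain z where z: "z \<noteq> 0" "nrm M z = \<kappa> * nrm E z"
  proof (rule norm_ratio_intermediate)
    show "nrm M x \<le> \<kappa> * nrm E x"
      using x(2) \<kappa> mult_right_mono[of 1 \<kappa> "nrm E x"] by simp
    show "\<kappa> * nrm E y \<le> nrm M y"
      using y(2) \<kappa> by (simp add: power2_eq_square mult_right_mono)
  qed (use x y in auto)
  define P where "P = normed_space_of (\<lambda>x. max (nrm E x) (1 / \<kappa> * nrm M x))"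
  \<comment> \<open>A midpoint \<open>K\<close> has to lie below both \<open>\<kappa>\<close> times
    \<open>E\<close> and \<open>M\<close>, whose minimum need not be a norm; this weighted mean of
    \<open>E\<close> and \<open>M\<close> is a norm below both.\<close>
  define Q where "Q = normed_space_of (\<lambda>x. \<kappa> / (\<kappa> + 1) * nrm E x + 1 / (\<kappa> + 1) * nrm M x)"
  have "is_norm (\<lambda>x. max (nrm E x) (1 / \<kappa> * nrm M x))"
    using \<kappa> by (intro is_norm_max is_norm_scale is_norm_nrm) simp
  then have P: "nrm P x = max (nrm E x) (1 / \<kappa> * nrm M x)" for x
    unfolding P_def by (simp add: nrm_normed_space_of)
  have "is_norm (\<lambda>x. \<kappa> / (\<kappa> + 1) * nrm E x + 1 / (\<kappa> + 1) * nrm M x)"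
    using \<kappa> by (intro is_norm_lincomb is_norm_nrm) auto
  then have Q: "nrm Q x = (\<kappa> * nrm E x + nrm M x) / (\<kappa> + 1)" for x
    unfolding Q_def by (simp add: nrm_normed_space_of add_divide_distrib)
  have PQ: "nrm P x \<le> nrm Q x" for x
  proof -
    have "(\<kappa> + 1) * nrm M x \<le> \<kappa> * (\<kappa> * nrm E x + nrm M x)"
      using EM(2)[of x] by (simp add: power2_eq_square algebra_simps)
    then have "1 / \<kappa> * nrm M x \<le> nrm Q x" using \<kappa> by (simp add: Q field_simps)
    moreover have "nrm E x \<le> nrm Q x" using EM(1)[of x] \<kappa> by (simp add: Q field_simps)
    ultimately show ?thesis by (simp add: P)
  qed
  have QM: "nrm Q x \<le> nrm M x" for x
    using EM(1)[of x] \<kappa> by (simp add: Q field_simps)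
  have QE: "nrm Q x \<le> \<kappa> * nrm E x" for x
    using EM(2)[of x] \<kappa> by (simp add: Q field_simps power2_eq_square)
  let ?I = "{K. \<forall>x. nrm P x \<le> nrm K x \<and> nrm K x \<le> nrm Q x}"
  have "nrm P x = nrm Q x"
    using PQ[of x] QM[of x] x(2) max.cobounded1[of "nrm E x" "1 / \<kappa> * nrm M x"]
    unfolding P by linarith
  moreover have "nrm P z < nrm Q z"
  proof -
    have "nrm P z = nrm E z" using \<kappa> by (simp add: P z(2))
    moreover have "nrm E z * (\<kappa> + 1) < 2 * \<kappa> * nrm E z"
      using nrm_pos[OF z(1), of E] \<kappa> by (simp add: algebra_simps)
    ultimately show ?thesis using \<kappa> by (simp add: Q z(2) field_simps)
  qed
  ultimately have uncountable: "uncountable (isometry_class ` ?I)"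
    using \<open>2 \<le> CARD('n)\<close> PQ x(1) by (intro uncountable_norm_interval)
  have K: "nrm E x \<le> nrm K x \<and> nrm K x \<le> \<kappa> * nrm E x \<and> nrm K x \<le> nrm M x \<and> nrm M x \<le> \<kappa> * nrm K x"
    if "K \<in> ?I" for K x
  proof -
    have "nrm P x \<le> nrm K x" "nrm K x \<le> nrm Q x" using that by auto
    moreover have "nrm M x \<le> \<kappa> * nrm P x"
      using \<kappa> mult_left_mono[of "1 / \<kappa> * nrm M x" "nrm P x" \<kappa>] by (simp add: P)
    moreover have "\<kappa> * nrm P x \<le> \<kappa> * nrm K x"
      using calculation(1) \<kappa> by (intro mult_left_mono) auto
    ultimately show ?thesis using QM[of x] QE[of x] P[of x] by linarith
  qed
  have "dist (isometry_class E) (isometry_class K) = ln \<kappa>" if "K \<in> ?I" for K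
  proof -
    have "banach_mazur E K \<le> \<kappa> * 1" "banach_mazur K M \<le> \<kappa> * 1"
      using K[OF that] \<kappa> by (intro banach_mazur_le_bounds; simp)+
    then have le: "banach_mazur E K \<le> \<kappa>" "banach_mazur K M \<le> \<kappa>" by simp_all
    \<comment> \<open>As \<open>K\<close> is within factor \<open>\<kappa>\<close> of
      \<open>M\<close>, and \<open>M\<close> is at \<open>\<kappa>\<^sup>2\<close> from
      \<open>E\<close>, \<open>K\<close> cannot be nearer to \<open>E\<close> than
      \<open>\<kappa>\<close>. Hence all these \<open>K\<close> are equally far from
      \<open>E\<close>.\<close>
    have "\<kappa> * \<kappa> \<le> banach_mazur E K * banach_mazur K M"
      using banach_mazur_triangle[of E M K] by (simp add: d_eq d power2_eq_square)
    also have "\<dots> \<le> banach_mazur E K * \<kappa>"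
      using le(2) banach_mazur_ge_1[of E K] by (intro mult_left_mono) auto
    finally have "\<kappa> \<le> banach_mazur E K" using \<kappa> by simp
    then show ?thesis using le(1) by (simp add: dist_isometry_class)
  qed
  moreover have "\<exists>\<tau>\<in>geodesic_traces (isometry_class E) (isometry_class M). isometry_class K \<in> \<tau>"
    if "K \<in> ?I" for K
    using K[OF that] \<kappa> EM by (intro geodesic_through[where \<kappa> = \<kappa>]) (auto simp: d_eq d)
  ultimately show ?thesis
    unfolding class_M[symmetric]
    by (intro uncountable_geodesic_traces[OF uncountable, where r = "ln \<kappa>"]) blast+
qed

end
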